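(* Let $G=(V,E)$ be a finite simple graph and let $w\colon E\to\mathbb{R}_+$ be a weight function. Then $\|d_w\|_+\le w(E)-\nu^*_w(G)$.
   Context: $\mathbb{R}_+$ denotes the nonnegative reals and $w(E)=\sum_{e\in E}w(e)$. The weighted cut function $d_w\colon 2^V\to\mathbb{R}$ assigns to $X\subseteq V$ the total weight of the edges with exactly one endpoint in $X$. Let $\mathcal{T}$ be the family of vertex sets of triangles of $G$, and for $T\in\mathcal{T}$ let $E[T]$ be the set of the three edges of $G$ induced by $T$. A weighted fractional triangle packing is a function $x\colon\mathcal{T}\to\mathbb{R}_+$ with $\sum_{T\in\mathcal{T},\,e\in E[T]}x(T)\le w(e)$ for each $e\in E$. The weighted fractional triangle packing number is $\nu^*_w(G)=\max\{\sum_{T\in\mathcal{T}}x(T)\mid x\text{ is a weighted fractional triangle packing}\}$. A set function $\varphi\colon 2^V\to\mathbb{R}$ is increasing (decreasing) if $X\subseteq Y$ implies $\varphi(X)\le\varphi(Y)$ (respectively $\varphi(X)\ge\varphi(Y)$), and submodular if $\varphi(X)+\varphi(Y)\ge\varphi(X\cap Y)+\varphi(X\cup Y)$ for all $X,Y\subseteq V$. A monotonic sum-decomposition of $\varphi$ (with $\varphi(\emptyset)=0$) is $\varphi=\varphi_1+\varphi_2$ with $\varphi_1$ increasing submodular, $\varphi_2$ decreasing submodular, $\varphi_1(\emptyset)=\varphi_2(\emptyset)=0$. Define $\|\varphi\|_+=\min\{\varphi_1(V)\mid\varphi=\varphi_1+\varphi_2\text{ is a monotonic sum-decomposition}\}$.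 *)

theory Defs
  imports Complex_Main
begin

text \<open>Set functions on the subsets of \<open>V\<close> are functions \<open>'a set \<Rightarrow> real\<close>
  of which only the values on \<open>Pow V\<close> matter; likewise, edge weights and triangle
  packings matter only on the edges and triangles of the graph.\<close>

definition finite_simple_graph :: "'a set \<Rightarrow> 'a set set \<Rightarrow> bool" where
  "finite_simple_graph V E \<longleftrightarrow> finite V \<and> E \<subseteq> {e. e \<subseteq> V \<and> card e = 2}"

definition weighted_cut :: "'a set set \<Rightarrow> ('a set \<Rightarrow> real) \<Rightarrow> 'a set \<Rightarrow> real" where
  "weighted_cut E w X = (\<Sum>e | e \<in> E \<and> card (e \<inter> X) = 1. w e)"

definition induced_edges :: "'a set set \<Rightarrow> 'a set \<Rightarrow> 'a set set" where
  "induced_edges E T = {e \<in> E. e \<subseteq> T}"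

definition triangles :: "'a set \<Rightarrow> 'a set set \<Rightarrow> 'a set set" where
  "triangles V E =
     {T. T \<subseteq> V \<and> card T = 3 \<and> (\<forall>u\<in>T. \<forall>v\<in>T. u \<noteq> v \<longrightarrow> {u, v} \<in> E)}"

definition weighted_fractional_triangle_packing ::
    "'a set \<Rightarrow> 'a set set \<Rightarrow> ('a set \<Rightarrow> real) \<Rightarrow> ('a set \<Rightarrow> real) \<Rightarrow> bool" where
  "weighted_fractional_triangle_packing V E w x \<longleftrightarrow>
     (\<forall>T\<in>triangles V E. 0 \<le> x T) \<and>
     (\<forall>e\<in>E. (\<Sum>T | T \<in> triangles V E \<and> e \<in> induced_edges E T. x T) \<le> w e)"

definition fractional_triangle_packing_number ::
    "'a set \<Rightarrow> 'a set set \<Rightarrow> ('a set \<Rightarrow> real) \<Rightarrow> real" where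
  "fractional_triangle_packing_number V E w =
     (GREATEST s. \<exists>x. weighted_fractional_triangle_packing V E w x \<and>
                      s = (\<Sum>T\<in>triangles V E. x T))"

definition submodular_on :: "'a set \<Rightarrow> ('a set \<Rightarrow> real) \<Rightarrow> bool" where
  "submodular_on V \<phi> \<longleftrightarrow>
     (\<forall>X Y. X \<subseteq> V \<longrightarrow> Y \<subseteq> V \<longrightarrow> \<phi> X + \<phi> Y \<ge> \<phi> (X \<inter> Y) + \<phi> (X \<union> Y))"

definition monotonic_sum_decomposition ::
    "'a set \<Rightarrow> ('a set \<Rightarrow> real) \<Rightarrow> ('a set \<Rightarrow> real) \<Rightarrow> ('a set \<Rightarrow> real) \<Rightarrow> bool" where
  "monotonic_sum_decomposition V \<phi> \<phi>1 \<phi>2 \<longleftrightarrow>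
     (\<forall>X. X \<subseteq> V \<longrightarrow> \<phi> X = \<phi>1 X + \<phi>2 X) \<and>
     mono_on (Pow V) \<phi>1 \<and> submodular_on V \<phi>1 \<and> \<phi>1 {} = 0 \<and>
     antimono_on (Pow V) \<phi>2 \<and> submodular_on V \<phi>2 \<and> \<phi>2 {} = 0"

text \<open>\<open>LEAST\<close> and \<open>GREATEST\<close> at type \<^typ>\<open>real\<close> denote an attained minimum or
  maximum, and are unspecified if there is none.\<close>

definition plus_norm :: "'a set \<Rightarrow> ('a set \<Rightarrow> real) \<Rightarrow> real" where
  "plus_norm V \<phi> =
     (LEAST c. \<exists>\<phi>1 \<phi>2. monotonic_sum_decomposition V \<phi> \<phi>1 \<phi>2 \<and> c = \<phi>1 V)"

end

theory Submission imports Defs begin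

text \<open>
  The right-hand side is reached by splitting the cut function along an optimal packing \<open>x\<close>.
  For a nonempty vertex set \<open>S\<close> let \<open>hits S X\<close> be 1 if \<open>X\<close> meets \<open>S\<close> and \<open>covers S X\<close> be 1
  if \<open>X\<close> contains \<open>S\<close>. The indicator that \<open>X\<close> splits \<open>S\<close> is \<open>hits S X - covers S X\<close>, and this is
  a monotonic sum-decomposition whose increasing part has total value 1. The cut function of a
  single edge is such an indicator. The cut function of a triangle \<open>T\<close> is twice the indicator that
  \<open>X\<close> splits \<open>T\<close>, so treating the three edges jointly costs 2 instead of 3: every unit of packed
  triangle saves exactly 1. Give each triangle \<open>T\<close> the coefficient \<open>2 * x T\<close> and each edge its residual
  weight, which is nonnegative by the packing constraint (\<open>cut_eq_edge_part_plus_triangle_part\<close>). The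
  increasing part of the sum has value \<open>w(E) - \<Sum>x\<close>.

  Since the norm and the packing number are an attained minimum and an attained maximum, both
  optima have to be shown to exist. Each is an optimum of a continuous objective over a closed bounded
  set of functions on a finite set, so the Bolzano-Weierstrass argument in
  \<open>attains_minimum_on_bounded_closed\<close> covers both: packings are bounded by the edge weights, and
  increasing parts of nearly optimal decompositions are bounded by their value at \<open>V\<close>.
\<close>

section \<open>Existence of optima over finite index sets\<close>

text \<open>Thin the sequence out one coordinate at a time: a bounded real sequence has a convergent
  monotone subsequence, and subsequences keep the limits already reached.\<close>

lemma pointwise_convergent_subsequence:
  fixes F :: "nat \<Rightarrow> 'b \<Rightarrow> real"
  assumes "finite S" and "\<And>n s. s \<in> S \<Longrightarrow> \<bar>F n s\<bar> \<le> B"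
  shows "\<exists>r g. strict_mono r \<and> (\<forall>s\<in>S. (\<lambda>n. F (r n) s) \<longlonglongrightarrow> g s)"
  using assms
proof (induction S rule: finite_induct)
  case empty
  then show ?case using strict_mono_id by auto
next
  case (insert a S)
  then obtain r g where r: "strict_mono r" and g: "\<And>s. s \<in> S \<Longrightarrow> (\<lambda>n. F (r n) s) \<longlonglongrightarrow> g s"
    by (metis insertCI)
  obtain q :: "nat \<Rightarrow> nat" where q: "strict_mono q" "monoseq (\<lambda>n. F (r (q n)) a)"
    using seq_monosub[of "\<lambda>n. F (r n) a"] by auto
  have "Bseq (\<lambda>n. F (r (q n)) a)"
    by (rule BseqI'[of _ B]) (simp add: insert.prems)
  then obtain l where l: "(\<lambda>n. F (r (q n)) a) \<longlonglongrightarrow> l"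
    using Bseq_monoseq_convergent q(2) by (auto simp: convergent_def)
  have "(\<lambda>n. F (r (q n)) s) \<longlonglongrightarrow> g s" if "s \<in> S" for s
    using LIMSEQ_subseq_LIMSEQ[OF g[OF that] q(1)] by (simp add: o_def)
  then have "\<forall>s\<in>insert a S. (\<lambda>n. F ((r \<circ> q) n) s) \<longlonglongrightarrow> (g(a := l)) s"
    using l insert.hyps by auto
  moreover have "strict_mono (r \<circ> q)"
    using r q(1) by (rule strict_mono_o)
  ultimately show ?case by blast
qed

text \<open>A subsequence of a minimizing sequence converges on \<open>S\<close>. Only the values on \<open>S\<close> are controlled, so
  membership in \<open>A\<close> and the objective must pass to every function with the right limits there.\<close>

lemma attains_minimum_on_bounded_closed:
  fixes L :: "('b \<Rightarrow> real) \<Rightarrow> real"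
  assumes "finite S" and "A \<noteq> {}"
    and bounded: "\<And>f s. f \<in> A \<Longrightarrow> s \<in> S \<Longrightarrow> \<bar>f s\<bar> \<le> B"
    and below: "\<And>f. f \<in> A \<Longrightarrow> C \<le> L f"
    and closed: "\<And>F g. (\<And>n::nat. F n \<in> A) \<Longrightarrow> (\<And>s. s \<in> S \<Longrightarrow> (\<lambda>n. F n s) \<longlonglongrightarrow> g s) \<Longrightarrow> g \<in> A"
    and continuous: "\<And>F g. (\<And>n::nat. F n \<in> A) \<Longrightarrow> (\<And>s. s \<in> S \<Longrightarrow> (\<lambda>n. F n s) \<longlonglongrightarrow> g s)
                        \<Longrightarrow> (\<lambda>n. L (F n)) \<longlonglongrightarrow> L g"
  shows "\<exists>g\<in>A. \<forall>f\<in>A. L g \<le> L f"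
proof -
  define m where "m = Inf (L ` A)"
  have bdd: "bdd_below (L ` A)"
    using below by (auto simp: bdd_below_def)
  have m_le: "m \<le> L f" if "f \<in> A" for f
    unfolding m_def using bdd that by (intro cInf_lower) auto
  have "\<exists>f\<in>A. L f < m + inverse (real (Suc n))" for n
  proof -
    have "Inf (L ` A) < m + inverse (real (Suc n))"
      by (simp add: m_def)
    then show ?thesis
      using cInf_less_iff[of "L ` A"] bdd \<open>A \<noteq> {}\<close> by blast
  qed
  then obtain F where F: "\<And>n. F n \<in> A" "\<And>n. L (F n) < m + inverse (real (Suc n))"
    by metis
  have "\<exists>r g. strict_mono r \<and> (\<forall>s\<in>S. (\<lambda>n. F (r n) s) \<longlonglongrightarrow> g s)"
    using \<open>finite S\<close> bounded[OF F(1)] by (rule pointwise_convergent_subsequence)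
  then obtain r g where r: "strict_mono r" and g: "\<And>s. s \<in> S \<Longrightarrow> (\<lambda>n. F (r n) s) \<longlonglongrightarrow> g s"
    by blast
  have "g \<in> A"
    by (rule closed[of "\<lambda>n. F (r n)"]) (use F g in auto)
  have lim: "(\<lambda>n. L (F (r n))) \<longlonglongrightarrow> L g"
    by (rule continuous) (use F g in auto)
  have "(\<lambda>n. m + inverse (real (Suc n))) \<longlonglongrightarrow> m"
    using tendsto_add[OF tendsto_const LIMSEQ_inverse_real_of_nat, of m] by simp
  from LIMSEQ_subseq_LIMSEQ[OF this r]
  have "(\<lambda>n. m + inverse (real (Suc (r n)))) \<longlonglongrightarrow> m"
    by (simp add: o_def)
  then have "L g \<le> m"
    by (rule LIMSEQ_le[OF lim]) (use F(2) less_imp_le in blast)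
  then show ?thesis
    using \<open>g \<in> A\<close> m_le by force
qed

section \<open>The norm as an attained minimum\<close>

text \<open>On subsets of \<open>V\<close> the decreasing part is the remainder left by the increasing part. Hence a
  decomposition amounts to a single function, and a limit of increasing parts determines a limit
  of decompositions.\<close>

lemma monotonic_sum_decomposition_first_part:
  assumes "monotonic_sum_decomposition V \<phi> f g"
  shows "monotonic_sum_decomposition V \<phi> f (\<lambda>X. \<phi> X - f X)"
proof -
  have eq: "\<phi> X - f X = g X" if "X \<subseteq> V" for X
    using assms that by (simp add: monotonic_sum_decomposition_def)
  have f: "f {} = 0" "mono_on (Pow V) f" "submodular_on V f"
    and g: "g {} = 0" "antimono_on (Pow V) g" "submodular_on V g"
    using assms by (simp_all add: monotonic_sum_decomposition_def)
  have "antimono_on (Pow V) (\<lambda>X. \<phi> X - f X)"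
  proof (rule monotone_onI)
    fix X Y assume "X \<in> Pow V" "Y \<in> Pow V" "X \<subseteq> Y"
    then show "\<phi> Y - f Y \<le> \<phi> X - f X"
      using eq monotone_onD[OF g(2)] by simp
  qed
  moreover have "submodular_on V (\<lambda>X. \<phi> X - f X)"
    unfolding submodular_on_def
  proof (intro allI impI)
    fix X Y assume XY: "X \<subseteq> V" "Y \<subseteq> V"
    then have sub: "X \<inter> Y \<subseteq> V" "X \<union> Y \<subseteq> V" by auto
    show "\<phi> X - f X + (\<phi> Y - f Y) \<ge> \<phi> (X \<inter> Y) - f (X \<inter> Y) + (\<phi> (X \<union> Y) - f (X \<union> Y))"
      unfolding eq[OF XY(1)] eq[OF XY(2)] eq[OF sub(1)] eq[OF sub(2)]
      by (rule g(3)[unfolded submodular_on_def, rule_format, OF XY])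
  qed
  moreover have "\<phi> {} - f {} = 0"
    using eq[of "{}"] g(1) by simp
  ultimately show ?thesis
    using f by (simp add: monotonic_sum_decomposition_def)
qed

lemma submodular_on_limit:
  assumes "\<And>n::nat. submodular_on V (F n)"
    and lim: "\<And>X. X \<subseteq> V \<Longrightarrow> (\<lambda>n. F n X) \<longlonglongrightarrow> g X"
  shows "submodular_on V g"
  unfolding submodular_on_def
proof (intro allI impI)
  fix X Y assume XY: "X \<subseteq> V" "Y \<subseteq> V"
  then have sub: "X \<inter> Y \<subseteq> V" "X \<union> Y \<subseteq> V" by auto
  have "F n (X \<inter> Y) + F n (X \<union> Y) \<le> F n X + F n Y" for n
    by (rule assms(1)[unfolded submodular_on_def, rule_format, OF XY])
  then show "g X + g Y \<ge> g (X \<inter> Y) + g (X \<union> Y)"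
    using LIMSEQ_le[OF tendsto_add[OF lim[OF sub(1)] lim[OF sub(2)]]
        tendsto_add[OF lim[OF XY(1)] lim[OF XY(2)]]] by simp
qed

lemma mono_on_limit:
  fixes F :: "nat \<Rightarrow> 'a::order \<Rightarrow> real"
  assumes "\<And>n. mono_on A (F n)" and lim: "\<And>X. X \<in> A \<Longrightarrow> (\<lambda>n. F n X) \<longlonglongrightarrow> g X"
  shows "mono_on A g"
proof (rule mono_onI)
  fix X Y assume XY: "X \<in> A" "Y \<in> A" "X \<le> Y"
  have "F n X \<le> F n Y" for n
    by (rule mono_onD[OF assms(1) XY])
  then show "g X \<le> g Y"
    using LIMSEQ_le[OF lim[OF XY(1)] lim[OF XY(2)]] by simp
qed

lemma antimono_on_limit:
  fixes F :: "nat \<Rightarrow> 'a::order \<Rightarrow> real"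
  assumes "\<And>n. antimono_on A (F n)" and lim: "\<And>X. X \<in> A \<Longrightarrow> (\<lambda>n. F n X) \<longlonglongrightarrow> g X"
  shows "antimono_on A g"
proof (rule monotone_onI)
  fix X Y assume XY: "X \<in> A" "Y \<in> A" "X \<le> Y"
  have "F n Y \<le> F n X" for n
    by (rule monotone_onD[OF assms(1) XY])
  then show "g Y \<le> g X"
    using LIMSEQ_le[OF lim[OF XY(2)] lim[OF XY(1)]] by simp
qed

lemma monotonic_sum_decomposition_closed:
  assumes dec: "\<And>n::nat. monotonic_sum_decomposition V \<phi> (F n) (\<lambda>X. \<phi> X - F n X)"
    and lim: "\<And>X. X \<subseteq> V \<Longrightarrow> (\<lambda>n. F n X) \<longlonglongrightarrow> g X"
  shows "monotonic_sum_decomposition V \<phi> g (\<lambda>X. \<phi> X - g X)"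
proof -
  have F: "F n {} = 0" "mono_on (Pow V) (F n)" "submodular_on V (F n)"
    and rest: "\<phi> {} - F n {} = 0" "antimono_on (Pow V) (\<lambda>X. \<phi> X - F n X)"
      "submodular_on V (\<lambda>X. \<phi> X - F n X)" for n
    using dec[of n] by (simp_all add: monotonic_sum_decomposition_def)
  have lim_rest: "(\<lambda>n. \<phi> X - F n X) \<longlonglongrightarrow> \<phi> X - g X" if "X \<subseteq> V" for X
    by (intro tendsto_diff tendsto_const lim that)
  have "g {} = 0"
    using lim[of "{}"] by (simp add: F(1) LIMSEQ_const_iff)
  moreover have "\<phi> {} = 0"
    using F(1) rest(1) by simp
  moreover have "mono_on (Pow V) g"
    by (rule mono_on_limit[of "Pow V" F, OF F(2)]) (simp add: lim)
  moreover have "submodular_on V g"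
    by (rule submodular_on_limit[of V F, OF F(3)]) (rule lim)
  moreover have "antimono_on (Pow V) (\<lambda>X. \<phi> X - g X)"
    by (rule antimono_on_limit[of "Pow V" "\<lambda>n X. \<phi> X - F n X", OF rest(2)]) (simp add: lim_rest)
  moreover have "submodular_on V (\<lambda>X. \<phi> X - g X)"
    by (rule submodular_on_limit[of V "\<lambda>n X. \<phi> X - F n X", OF rest(3)]) (rule lim_rest)
  ultimately show ?thesis
    by (simp add: monotonic_sum_decomposition_def)
qed

text \<open>Only decompositions at most as expensive as the given one compete for the minimum. For these,
  monotonicity confines the increasing part to the interval from 0 to the value of the given
  one at \<open>V\<close>, which supplies the bound needed for compactness.\<close>

lemma plus_norm_le:
  assumes "finite V" and dec: "monotonic_sum_decomposition V \<phi> \<phi>1 \<phi>2"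
  shows "plus_norm V \<phi> \<le> \<phi>1 V"
proof -
  define A where
    "A = {f. monotonic_sum_decomposition V \<phi> f (\<lambda>X. \<phi> X - f X) \<and> f V \<le> \<phi>1 V}"
  have "\<phi>1 \<in> A"
    using monotonic_sum_decomposition_first_part[OF dec] by (simp add: A_def)
  have bounds: "0 \<le> f X \<and> f X \<le> \<phi>1 V" if "f \<in> A" "X \<subseteq> V" for f X
  proof -
    have "f {} = 0" "f V \<le> \<phi>1 V" and mono: "mono_on (Pow V) f"
      using that(1) by (simp_all add: A_def monotonic_sum_decomposition_def)
    moreover have "f {} \<le> f X" "f X \<le> f V"
      using that(2) by (auto intro!: mono_onD[OF mono])
    ultimately show ?thesis by linarith
  qed
  have "\<exists>g\<in>A. \<forall>f\<in>A. g V \<le> f V"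
  proof (rule attains_minimum_on_bounded_closed[where S = "Pow V"])
    show "\<bar>f X\<bar> \<le> \<phi>1 V" if "f \<in> A" "X \<in> Pow V" for f X
      using bounds that by fastforce
    show "0 \<le> f V" if "f \<in> A" for f
      using bounds that by blast
  next
    fix F :: "nat \<Rightarrow> 'a set \<Rightarrow> real" and g
    assume F: "\<And>n. F n \<in> A" and lim: "\<And>X. X \<in> Pow V \<Longrightarrow> (\<lambda>n. F n X) \<longlonglongrightarrow> g X"
    have "monotonic_sum_decomposition V \<phi> g (\<lambda>X. \<phi> X - g X)"
    proof (rule monotonic_sum_decomposition_closed)
      show "monotonic_sum_decomposition V \<phi> (F n) (\<lambda>X. \<phi> X - F n X)" for n
        using F[of n] by (simp add: A_def)
      show "(\<lambda>n. F n X) \<longlonglongrightarrow> g X" if "X \<subseteq> V" for X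
        using that by (simp add: lim)
    qed
    moreover have "g V \<le> \<phi>1 V"
    proof (rule LIMSEQ_le_const2[OF lim])
      show "\<exists>N. \<forall>n\<ge>N. F n V \<le> \<phi>1 V"
        using F by (simp add: A_def)
    qed simp
    ultimately show "g \<in> A"
      by (simp add: A_def)
  qed (use \<open>finite V\<close> \<open>\<phi>1 \<in> A\<close> in auto)
  then obtain g where "g \<in> A" and g: "\<And>f. f \<in> A \<Longrightarrow> g V \<le> f V"
    by blast
  have "plus_norm V \<phi> = g V"
    unfolding plus_norm_def
  proof (rule Least_equality)
    show "\<exists>\<phi>1 \<phi>2. monotonic_sum_decomposition V \<phi> \<phi>1 \<phi>2 \<and> g V = \<phi>1 V"
      using \<open>g \<in> A\<close> by (auto simp: A_def)
    fix c assume "\<exists>\<psi>1 \<psi>2. monotonic_sum_decomposition V \<phi> \<psi>1 \<psi>2 \<and> c = \<psi>1 V"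
    then obtain \<psi>1 \<psi>2 where \<psi>: "monotonic_sum_decomposition V \<phi> \<psi>1 \<psi>2" "c = \<psi>1 V"
      by blast
    show "g V \<le> c"
    proof (cases "\<psi>1 V \<le> \<phi>1 V")
      case True
      then have "\<psi>1 \<in> A"
        using monotonic_sum_decomposition_first_part[OF \<psi>(1)] by (simp add: A_def)
      then show ?thesis using g \<psi>(2) by simp
    next
      case False
      then show ?thesis using g[OF \<open>\<phi>1 \<in> A\<close>] \<psi>(2) by simp
    qed
  qed
  then show ?thesis
    using g[OF \<open>\<phi>1 \<in> A\<close>] by simp
qed

section \<open>Decompositions from hitting and covering\<close>

definition hits :: "'a set \<Rightarrow> 'a set \<Rightarrow> real" where
  "hits S X = of_bool (S \<inter> X \<noteq> {})"

definition covers :: "'a set \<Rightarrow> 'a set \<Rightarrow> real" where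
  "covers S X = of_bool (S \<subseteq> X)"

lemma hits_mono: "X \<subseteq> Y \<Longrightarrow> hits S X \<le> hits S Y"
  by (auto simp: hits_def)

lemma covers_mono: "X \<subseteq> Y \<Longrightarrow> covers S X \<le> covers S Y"
  by (auto simp: covers_def)

lemma hits_submodular: "hits S (X \<inter> Y) + hits S (X \<union> Y) \<le> hits S X + hits S Y"
  by (auto simp: hits_def)

lemma covers_supermodular: "covers S X + covers S Y \<le> covers S (X \<inter> Y) + covers S (X \<union> Y)"
  by (auto simp: covers_def)

text \<open>Nonemptiness of the sets is what makes the decreasing part vanish at the empty set.\<close>

lemma monotonic_sum_decomposition_hits_covers:
  assumes "\<And>S. S \<in> F \<Longrightarrow> S \<noteq> {}" and nonneg: "\<And>S. S \<in> F \<Longrightarrow> 0 \<le> a S"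
  shows "monotonic_sum_decomposition V (\<lambda>X. \<Sum>S\<in>F. a S * (hits S X - covers S X))
           (\<lambda>X. \<Sum>S\<in>F. a S * hits S X) (\<lambda>X. - (\<Sum>S\<in>F. a S * covers S X))"
  unfolding monotonic_sum_decomposition_def submodular_on_def
proof (intro conjI allI impI)
  show "mono_on (Pow V) (\<lambda>X. \<Sum>S\<in>F. a S * hits S X)"
    by (intro mono_onI sum_mono mult_left_mono hits_mono nonneg)
  show "antimono_on (Pow V) (\<lambda>X. - (\<Sum>S\<in>F. a S * covers S X))"
    by (auto intro!: monotone_onI sum_mono mult_left_mono covers_mono nonneg)
  show "(\<Sum>S\<in>F. a S * hits S {}) = 0"
    by (simp add: hits_def)
  show "- (\<Sum>S\<in>F. a S * covers S {}) = 0"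
    using assms(1) by (simp add: covers_def)
  fix X Y
  show "(\<Sum>S\<in>F. a S * (hits S X - covers S X))
      = (\<Sum>S\<in>F. a S * hits S X) + - (\<Sum>S\<in>F. a S * covers S X)"
    by (simp add: right_diff_distrib sum_subtractf)
  have "(\<Sum>S\<in>F. a S * (hits S (X \<inter> Y) + hits S (X \<union> Y))) \<le> (\<Sum>S\<in>F. a S * (hits S X + hits S Y))"
    by (intro sum_mono mult_left_mono hits_submodular nonneg)
  then show "(\<Sum>S\<in>F. a S * hits S X) + (\<Sum>S\<in>F. a S * hits S Y)
      \<ge> (\<Sum>S\<in>F. a S * hits S (X \<inter> Y)) + (\<Sum>S\<in>F. a S * hits S (X \<union> Y))"
    by (simp add: distrib_left sum.distrib)
  have "(\<Sum>S\<in>F. a S * (covers S X + covers S Y))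
      \<le> (\<Sum>S\<in>F. a S * (covers S (X \<inter> Y) + covers S (X \<union> Y)))"
    by (intro sum_mono mult_left_mono covers_supermodular nonneg)
  then show "- (\<Sum>S\<in>F. a S * covers S X) + - (\<Sum>S\<in>F. a S * covers S Y)
      \<ge> - (\<Sum>S\<in>F. a S * covers S (X \<inter> Y)) + - (\<Sum>S\<in>F. a S * covers S (X \<union> Y))"
    by (simp add: distrib_left sum.distrib)
qed

lemma monotonic_sum_decomposition_add:
  assumes "monotonic_sum_decomposition V \<phi> \<phi>1 \<phi>2" and "monotonic_sum_decomposition V \<psi> \<psi>1 \<psi>2"
  shows "monotonic_sum_decomposition V (\<lambda>X. \<phi> X + \<psi> X)
           (\<lambda>X. \<phi>1 X + \<psi>1 X) (\<lambda>X. \<phi>2 X + \<psi>2 X)"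
proof -
  have "submodular_on V (\<lambda>X. f X + g X)" if "submodular_on V f" "submodular_on V g" for f g
    unfolding submodular_on_def
  proof (intro allI impI)
    fix X Y assume "X \<subseteq> V" "Y \<subseteq> V"
    then have "f (X \<inter> Y) + f (X \<union> Y) \<le> f X + f Y" "g (X \<inter> Y) + g (X \<union> Y) \<le> g X + g Y"
      using that by (auto simp: submodular_on_def)
    then show "f X + g X + (f Y + g Y) \<ge> f (X \<inter> Y) + g (X \<inter> Y) + (f (X \<union> Y) + g (X \<union> Y))"
      by linarith
  qed
  then show ?thesis
    using assms unfolding monotonic_sum_decomposition_def monotone_on_def
    by (auto intro!: add_mono)
qed

section \<open>Cuts of edges and triangles\<close>

lemma edge_cut:
  assumes "card e = 2"
  shows "of_bool (card (e \<inter> X) = 1) = hits e X - covers e X"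
proof -
  obtain a b where e: "e = {a, b}" "a \<noteq> b"
    using assms by (auto simp: card_2_iff)
  show ?thesis
    using e(2) unfolding e(1)
    by (cases "a \<in> X"; cases "b \<in> X") (auto simp: hits_def covers_def Int_insert_left)
qed

lemma induced_edges_triangle:
  assumes E: "finite_simple_graph V E" and T: "T \<in> triangles V E"
  obtains a b c where "T = {a, b, c}" "a \<noteq> b" "a \<noteq> c" "b \<noteq> c"
    "induced_edges E T = {{a, b}, {a, c}, {b, c}}"
proof -
  obtain a b c where abc: "T = {a, b, c}" "a \<noteq> b" "a \<noteq> c" "b \<noteq> c"
    using T by (auto simp: triangles_def card_3_iff)
  have "{{a, b}, {a, c}, {b, c}} \<subseteq> induced_edges E T"
    using T abc by (auto simp: triangles_def induced_edges_def)
  moreover have "e \<in> {{a, b}, {a, c}, {b, c}}" if "e \<in> induced_edges E T" for e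
  proof -
    have "card e = 2" "e \<subseteq> {a, b, c}"
      using that E abc(1) by (auto simp: induced_edges_def finite_simple_graph_def)
    then show ?thesis
      by (auto simp: card_2_iff)
  qed
  ultimately have "induced_edges E T = {{a, b}, {a, c}, {b, c}}"
    by blast
  then show ?thesis
    using that abc by blast
qed

lemma card_induced_edges_triangle:
  assumes "finite_simple_graph V E" "T \<in> triangles V E"
  shows "card (induced_edges E T) = 3"
proof -
  obtain a b c where "a \<noteq> b" "a \<noteq> c" "b \<noteq> c" "induced_edges E T = {{a, b}, {a, c}, {b, c}}"
    using induced_edges_triangle[OF assms] .
  then show ?thesis
    by (auto simp: doubleton_eq_iff)
qed

text \<open>A cut that splits a triangle contains exactly two of its edges.\<close>

lemma triangle_cut:
  assumes "finite_simple_graph V E" "T \<in> triangles V E"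
  shows "(\<Sum>e\<in>induced_edges E T. of_bool (card (e \<inter> X) = 1)) = 2 * (hits T X - covers T X)"
proof -
  obtain a b c where abc: "T = {a, b, c}" "a \<noteq> b" "a \<noteq> c" "b \<noteq> c"
    and ind: "induced_edges E T = {{a, b}, {a, c}, {b, c}}"
    using induced_edges_triangle[OF assms] .
  have "{a, b} \<noteq> {a, c}" "{a, b} \<noteq> {b, c}" "{a, c} \<noteq> {b, c}"
    using abc by (auto simp: doubleton_eq_iff)
  then show ?thesis
    unfolding ind unfolding abc(1) using abc(2-4)
    by (cases "a \<in> X"; cases "b \<in> X"; cases "c \<in> X")
      (auto simp: hits_def covers_def Int_insert_left)
qed

section \<open>Fractional triangle packings\<close>

lemma finite_triangles: "finite_simple_graph V E \<Longrightarrow> finite (triangles V E)"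
  by (rule finite_subset[of _ "Pow V"]) (auto simp: triangles_def finite_simple_graph_def)

lemma finite_edges: "finite_simple_graph V E \<Longrightarrow> finite E"
  by (rule finite_subset[of _ "Pow V"]) (auto simp: finite_simple_graph_def)

lemma triangle_packing_le:
  assumes E: "finite_simple_graph V E"
    and x: "weighted_fractional_triangle_packing V E w x"
    and nonneg: "\<And>e. e \<in> E \<Longrightarrow> 0 \<le> w e" and T: "T \<in> triangles V E"
  shows "x T \<le> (\<Sum>e\<in>E. w e)"
proof -
  obtain e where e: "e \<in> induced_edges E T"
    using induced_edges_triangle[OF E T] by (metis insertI1)
  then have "e \<in> E"
    by (simp add: induced_edges_def)
  have "x T \<le> (\<Sum>T | T \<in> triangles V E \<and> e \<in> induced_edges E T. x T)"
    using T e x finite_triangles[OF E]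
    by (intro member_le_sum) (auto simp: weighted_fractional_triangle_packing_def)
  also have "\<dots> \<le> w e"
    using x \<open>e \<in> E\<close> by (simp add: weighted_fractional_triangle_packing_def)
  also have "\<dots> \<le> (\<Sum>e\<in>E. w e)"
    using \<open>e \<in> E\<close> nonneg finite_edges[OF E] by (intro member_le_sum) auto
  finally show ?thesis .
qed

lemma packing_number_attained:
  assumes E: "finite_simple_graph V E" and nonneg: "\<And>e. e \<in> E \<Longrightarrow> 0 \<le> w e"
  obtains x where "weighted_fractional_triangle_packing V E w x"
    "fractional_triangle_packing_number V E w = (\<Sum>T\<in>triangles V E. x T)"
proof -
  let ?A = "{x. weighted_fractional_triangle_packing V E w x}"
  let ?W = "\<Sum>e\<in>E. w e"
  \<comment> \<open>The packing number is a maximum, so the objective is negated.\<close>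
  have "\<exists>x\<in>?A. \<forall>y\<in>?A. - (\<Sum>T\<in>triangles V E. x T) \<le> - (\<Sum>T\<in>triangles V E. y T)"
  proof (rule attains_minimum_on_bounded_closed)
    show "finite (triangles V E)"
      using E by (rule finite_triangles)
    have "(\<lambda>_. 0) \<in> ?A"
      using nonneg by (simp add: weighted_fractional_triangle_packing_def)
    then show "?A \<noteq> {}" by blast
    show "\<bar>x T\<bar> \<le> ?W" if "x \<in> ?A" "T \<in> triangles V E" for x T
      using that triangle_packing_le[OF E, of w x T] nonneg
      by (simp add: weighted_fractional_triangle_packing_def)
    show "- (\<Sum>T\<in>triangles V E. ?W) \<le> - (\<Sum>T\<in>triangles V E. x T)" if "x \<in> ?A" for x
      using that triangle_packing_le[OF E, of w x] nonneg by (simp add: sum_mono del: sum_constant)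
  next
    fix F :: "nat \<Rightarrow> 'a set \<Rightarrow> real" and x
    assume F: "\<And>n. F n \<in> ?A" and lim: "\<And>T. T \<in> triangles V E \<Longrightarrow> (\<lambda>n. F n T) \<longlonglongrightarrow> x T"
    show "(\<lambda>n. - (\<Sum>T\<in>triangles V E. F n T)) \<longlonglongrightarrow> - (\<Sum>T\<in>triangles V E. x T)"
      by (intro tendsto_minus tendsto_sum lim)
    have "0 \<le> x T" if "T \<in> triangles V E" for T
      using that F by (intro LIMSEQ_le_const[OF lim])
        (auto simp: weighted_fractional_triangle_packing_def)
    moreover have "(\<Sum>T | T \<in> triangles V E \<and> e \<in> induced_edges E T. x T) \<le> w e" if "e \<in> E" for e
    proof (rule LIMSEQ_le_const2)
      show "(\<lambda>n. \<Sum>T | T \<in> triangles V E \<and> e \<in> induced_edges E T. F n T)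
          \<longlonglongrightarrow> (\<Sum>T | T \<in> triangles V E \<and> e \<in> induced_edges E T. x T)"
        by (intro tendsto_sum lim) auto
    qed (use F that in \<open>auto simp: weighted_fractional_triangle_packing_def\<close>)
    ultimately show "x \<in> ?A"
      by (simp add: weighted_fractional_triangle_packing_def)
  qed
  then obtain x where x: "x \<in> ?A"
    and max: "\<And>y. y \<in> ?A \<Longrightarrow> (\<Sum>T\<in>triangles V E. y T) \<le> (\<Sum>T\<in>triangles V E. x T)"
    by auto
  have "fractional_triangle_packing_number V E w = (\<Sum>T\<in>triangles V E. x T)"
    unfolding fractional_triangle_packing_number_def
    by (rule Greatest_equality) (use x max in auto)
  then show ?thesis
    using that x by blast
qed

definition residual_weight ::
    "'a set \<Rightarrow> 'a set set \<Rightarrow> ('a set \<Rightarrow> real) \<Rightarrow> ('a set \<Rightarrow> real) \<Rightarrow> 'a set \<Rightarrow> real" where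
  "residual_weight V E w x e =
     w e - (\<Sum>T | T \<in> triangles V E \<and> e \<in> induced_edges E T. x T)"

text \<open>Double counting of the incidences between edges and triangles. Taking \<open>k\<close> to be a cut indicator
  gives the decomposition of the cut function, and \<open>k = 1\<close> gives its cost.\<close>

lemma sum_weight_eq_residual_plus_packed:
  assumes E: "finite_simple_graph V E"
  shows "(\<Sum>e\<in>E. w e * k e) = (\<Sum>e\<in>E. residual_weight V E w x e * k e)
           + (\<Sum>T\<in>triangles V E. x T * (\<Sum>e\<in>induced_edges E T. k e))"
proof -
  have "(\<Sum>e\<in>E. (\<Sum>T | T \<in> triangles V E \<and> e \<in> induced_edges E T. x T) * k e)
      = (\<Sum>e\<in>E. \<Sum>T | T \<in> triangles V E \<and> e \<in> induced_edges E T. x T * k e)"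
    by (simp add: sum_distrib_right)
  also have "\<dots> = (\<Sum>T\<in>triangles V E. \<Sum>e | e \<in> E \<and> e \<in> induced_edges E T. x T * k e)"
    by (rule sum.swap_restrict[OF finite_edges[OF E] finite_triangles[OF E]])
  also have "\<dots> = (\<Sum>T\<in>triangles V E. x T * (\<Sum>e\<in>induced_edges E T. k e))"
    by (simp add: sum_distrib_left induced_edges_def)
  finally show ?thesis
    by (simp add: residual_weight_def left_diff_distrib sum_subtractf)
qed

text \<open>The edges of a triangle \<open>T\<close> receive \<open>x T\<close> each. As a split triangle has two edges in the cut, \<open>T\<close>
  contributes \<open>2 * x T\<close> times its splitting indicator.\<close>

lemma cut_eq_edge_part_plus_triangle_part:
  assumes E: "finite_simple_graph V E"
  shows "weighted_cut E w X =
           (\<Sum>e\<in>E. residual_weight V E w x e * (hits e X - covers e X))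
           + (\<Sum>T\<in>triangles V E. (2 * x T) * (hits T X - covers T X))"
proof -
  have "weighted_cut E w X = (\<Sum>e\<in>E. w e * of_bool (card (e \<inter> X) = 1))"
    unfolding weighted_cut_def using finite_edges[OF E]
    by (intro sum.mono_neutral_cong_left) auto
  also have "\<dots> = (\<Sum>e\<in>E. residual_weight V E w x e * of_bool (card (e \<inter> X) = 1))
      + (\<Sum>T\<in>triangles V E. x T * (\<Sum>e\<in>induced_edges E T. of_bool (card (e \<inter> X) = 1)))"
    by (rule sum_weight_eq_residual_plus_packed[OF E])
  also have "(\<Sum>e\<in>E. residual_weight V E w x e * of_bool (card (e \<inter> X) = 1))
      = (\<Sum>e\<in>E. residual_weight V E w x e * (hits e X - covers e X))"
    using E by (intro sum.cong refl arg_cong2[where f = "(*)"] edge_cut)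
      (auto simp: finite_simple_graph_def)
  also have "(\<Sum>T\<in>triangles V E. x T * (\<Sum>e\<in>induced_edges E T. of_bool (card (e \<inter> X) = 1)))
      = (\<Sum>T\<in>triangles V E. (2 * x T) * (hits T X - covers T X))"
    by (intro sum.cong refl) (simp only: triangle_cut[OF E] mult_ac)
  finally show ?thesis .
qed

theorem corollary7p8:
  fixes V :: "'a set" and E :: "'a set set" and w :: "'a set \<Rightarrow> real"
  assumes "finite_simple_graph V E"
    and "\<And>e. e \<in> E \<Longrightarrow> 0 \<le> w e"
  shows "plus_norm V (weighted_cut E w) \<le>
           (\<Sum>e\<in>E. w e) - fractional_triangle_packing_number V E w"
proof -
  note E = assms(1)
  obtain x where x: "weighted_fractional_triangle_packing V E w x"
    and number: "fractional_triangle_packing_number V E w = (\<Sum>T\<in>triangles V E. x T)"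
    using packing_number_attained[OF assms] .
  let ?\<phi>1 = "\<lambda>X. (\<Sum>e\<in>E. residual_weight V E w x e * hits e X)
                    + (\<Sum>T\<in>triangles V E. (2 * x T) * hits T X)"
  let ?\<phi>2 = "\<lambda>X. - (\<Sum>e\<in>E. residual_weight V E w x e * covers e X)
                    + - (\<Sum>T\<in>triangles V E. (2 * x T) * covers T X)"
  have edge: "e \<noteq> {}" "e \<subseteq> V" if "e \<in> E" for e
    using that E by (auto simp: finite_simple_graph_def)
  have triangle: "T \<noteq> {}" "T \<subseteq> V" if "T \<in> triangles V E" for T
    using that by (auto simp: triangles_def)
  have "monotonic_sum_decomposition V
      (\<lambda>X. (\<Sum>e\<in>E. residual_weight V E w x e * (hits e X - covers e X))
          + (\<Sum>T\<in>triangles V E. (2 * x T) * (hits T X - covers T X))) ?\<phi>1 ?\<phi>2"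
    using x edge(1) triangle(1)
    by (intro monotonic_sum_decomposition_add monotonic_sum_decomposition_hits_covers)
      (simp_all add: residual_weight_def weighted_fractional_triangle_packing_def)
  moreover have "weighted_cut E w =
      (\<lambda>X. (\<Sum>e\<in>E. residual_weight V E w x e * (hits e X - covers e X))
          + (\<Sum>T\<in>triangles V E. (2 * x T) * (hits T X - covers T X)))"
    by (intro ext cut_eq_edge_part_plus_triangle_part[OF E])
  ultimately have "monotonic_sum_decomposition V (weighted_cut E w) ?\<phi>1 ?\<phi>2"
    by simp
  moreover have "finite V"
    using E by (simp add: finite_simple_graph_def)
  ultimately have "plus_norm V (weighted_cut E w) \<le> ?\<phi>1 V"
    by (intro plus_norm_le)
  also have "?\<phi>1 V = (\<Sum>e\<in>E. residual_weight V E w x e) + (\<Sum>T\<in>triangles V E. 2 * x T)"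
    using edge triangle by (simp add: hits_def Int_absorb2)
  also have "\<dots> = (\<Sum>e\<in>E. w e) - (\<Sum>T\<in>triangles V E. x T)"
  proof -
    have "(\<Sum>e\<in>E. w e) = (\<Sum>e\<in>E. residual_weight V E w x e) + (\<Sum>T\<in>triangles V E. x T * 3)"
      using sum_weight_eq_residual_plus_packed[OF E, of w "\<lambda>_. 1" x]
      by (simp add: card_induced_edges_triangle[OF E])
    then show ?thesis
      by (simp add: sum_distrib_left[symmetric] sum_distrib_right[symmetric])
  qed
  finally show ?thesis
    by (simp add: number)
qed

end
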